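(* Let $n\ge 1$ and $w\in S_n$. Let $D(w)$ be the Rothe diagram of $w$ with columns $D_1,\ldots,D_n$, and set $d_j=\max(D_j)$ for each $j\in[n]$, with the convention $\max(\emptyset)=0$. Then \[\mathrm{Newton}(\mathfrak{G}_w)\subseteq \sum_{j=1}^n P_{\mathrm{sp}}(\mathrm{SM}_{d_j}(D_j)),\] where the sum is the Minkowski sum and each $P_{\mathrm{sp}}(\mathrm{SM}_{d_j}(D_j))\subseteq\mathbb{R}^{d_j}$ is regarded as a subset of $\mathbb{R}^n$ via the inclusion $\mathbb{R}^{d_j}\to\mathbb{R}^n$ appending zero coordinates.
   Context: Permutations act on the right; $s_j$ is the adjacent transposition swapping positions $j,j+1$, and $w(j)<w(j+1)$ is called an ascent. The divided difference operator on $\mathbb{Z}[x_1,\ldots,x_n]$ is $\partial_j f=\frac{f-s_j f}{x_j-x_{j+1}}$, where $s_jf$ swaps $x_j$ and $x_{j+1}$, and the isobaric divided difference is $\overline{\partial}_j f=\partial_j((1-x_{j+1})f)$. The Grothendieck polynomial $\mathfrak{G}_w$ is defined by $\mathfrak{G}_{w_0}=x_1^{n-1}x_2^{n-2}\cdots x_{n-1}$ for $w_0=n\,(n-1)\cdots 1$, and $\mathfrak{G}_w=\overline{\partial}_j\mathfrak{G}_{ws_j}$ whenever $w(j)<w(j+1)$. The support of a polynomial is the set of exponent vectors of its monomials with nonzero coefficient; $\mathrm{Newton}(f)$ is the convex hull of its support. The Rothe diagram is $D(w)=\{(i,j)\in[n]^2: i<w^{-1}(j),\ j<w(i)\}$,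 with column $D_j=\{i:(i,j)\in D(w)\}$. For $1\le s_1<\cdots<s_r\le m$, the Schubert matroid $\mathrm{SM}_m(\{s_1,\ldots,s_r\})$ is the matroid on ground set $[m]$ whose bases are the sets $\{a_1<\cdots<a_r\}\subseteq[m]$ with $a_k\le s_k$ for all $k$ (for $r=0$ the only basis is $\emptyset$). A spanning set of a matroid is a set containing some basis, and the spanning set polytope $P_{\mathrm{sp}}(M)$ is the convex hull of the indicator vectors of the spanning sets of $M$. *)

theory Defs
  imports "HOL-Analysis.Analysis" "HOL-Library.Poly_Mapping"
begin

text \<open>Polynomials in \<open>\<int>[x_1,x_2,...]\<close>: finitely supported maps from exponent vectors
  (finitely supported \<open>nat \<Rightarrow> nat\<close>) to integer coefficients.  Variable \<open>x_i\<close> has index \<open>i\<close>.\<close>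
type_synonym ipoly = "(nat \<Rightarrow>\<^sub>0 nat) \<Rightarrow>\<^sub>0 int"

definition var :: "nat \<Rightarrow> ipoly" where
  "var i = Poly_Mapping.single (Poly_Mapping.single i 1) 1"

definition swap_vars :: "nat \<Rightarrow> ipoly \<Rightarrow> ipoly" where
  "swap_vars j f =
     Poly_Mapping.map_key (\<lambda>a. Poly_Mapping.map_key (Transposition.transpose j (Suc j)) a) f"

definition divdiff :: "nat \<Rightarrow> ipoly \<Rightarrow> ipoly" where
  "divdiff j f = (THE g. (var j - var (Suc j)) * g = f - swap_vars j f)"

definition isobaric_divdiff :: "nat \<Rightarrow> ipoly \<Rightarrow> ipoly" where
  "isobaric_divdiff j f = divdiff j ((1 - var (Suc j)) * f)"

text \<open>Permutations of \<open>[n] = {1..n}\<close> as functions \<open>nat \<Rightarrow> nat\<close> fixing everything outside \<open>[n]\<close>.\<close>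
definition longest_perm :: "nat \<Rightarrow> nat \<Rightarrow> nat" where
  "longest_perm n = (\<lambda>i. if i \<in> {1..n} then n + 1 - i else i)"

definition groth_top :: "nat \<Rightarrow> ipoly" where
  "groth_top n = (\<Prod>i\<in>{1..n}. var i ^ (n - i))"

definition is_grothendieck_family :: "nat \<Rightarrow> ((nat \<Rightarrow> nat) \<Rightarrow> ipoly) \<Rightarrow> bool" where
  "is_grothendieck_family n G \<longleftrightarrow>
     G (longest_perm n) = groth_top n \<and>
     (\<forall>w j. w permutes {1..n} \<longrightarrow> j \<in> {1..<n} \<longrightarrow> w j < w (Suc j) \<longrightarrow>
        G w = isobaric_divdiff j (G (w \<circ> Transposition.transpose j (Suc j))))"

definition rothe :: "nat \<Rightarrow> (nat \<Rightarrow> nat) \<Rightarrow> (nat \<times> nat) set" where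
  "rothe n w = {(i, j). i \<in> {1..n} \<and> j \<in> {1..n} \<and> i < inv w j \<and> j < w i}"

definition rothe_col :: "nat \<Rightarrow> (nat \<Rightarrow> nat) \<Rightarrow> nat \<Rightarrow> nat set" where
  "rothe_col n w j = {i. (i, j) \<in> rothe n w}"

definition max0 :: "nat set \<Rightarrow> nat" where
  "max0 A = (if A = {} then 0 else Max A)"

definition schubert_basis :: "nat \<Rightarrow> nat set \<Rightarrow> nat set \<Rightarrow> bool" where
  "schubert_basis m S B \<longleftrightarrow>
     B \<subseteq> {1..m} \<and> card B = card S \<and>
     (\<forall>k < card S. sorted_list_of_set B ! k \<le> sorted_list_of_set S ! k)"

definition schubert_spanning :: "nat \<Rightarrow> nat set \<Rightarrow> nat set \<Rightarrow> bool" where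
  "schubert_spanning m S A \<longleftrightarrow> A \<subseteq> {1..m} \<and> (\<exists>B. schubert_basis m S B \<and> B \<subseteq> A)"

text \<open>Points of \<open>\<real>^n\<close> as \<open>nat \<Rightarrow> real\<close> (coordinate \<open>i\<close> for \<open>i \<in> [n]\<close>, zero elsewhere).
  Indicator vector of \<open>A \<subseteq> [m]\<close>, automatically padded by zeros.\<close>
definition indicator_vec :: "nat set \<Rightarrow> nat \<Rightarrow> real" where
  "indicator_vec A = (\<lambda>i. if i \<in> A then 1 else 0)"

definition conv_hull :: "(nat \<Rightarrow> real) set \<Rightarrow> (nat \<Rightarrow> real) set" where
  "conv_hull S = {x. \<exists>F u. finite F \<and> F \<subseteq> S \<and> F \<noteq> {} \<and> (\<forall>v\<in>F. 0 \<le> u v) \<and>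
                        (\<Sum>v\<in>F. u v) = 1 \<and> x = (\<lambda>k. \<Sum>v\<in>F. u v * v k)}"

definition spanning_polytope :: "nat \<Rightarrow> nat set \<Rightarrow> (nat \<Rightarrow> real) set" where
  "spanning_polytope m S = conv_hull (indicator_vec ` {A. schubert_spanning m S A})"

definition newton :: "ipoly \<Rightarrow> (nat \<Rightarrow> real) set" where
  "newton f = conv_hull ((\<lambda>a. \<lambda>i. real (Poly_Mapping.lookup a i)) ` Poly_Mapping.keys f)"

definition minkowski_sum :: "nat set \<Rightarrow> (nat \<Rightarrow> (nat \<Rightarrow> real) set) \<Rightarrow> (nat \<Rightarrow> real) set" where
  "minkowski_sum J P = {x. \<exists>p. (\<forall>j\<in>J. p j \<in> P j) \<and> x = (\<lambda>k. \<Sum>j\<in>J. p j k)}"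

end

theory Submission
  imports Defs
begin

text \<open>The proof rests on a cotransition formula. Let \<open>i\<close> be the first position where \<open>w\<close> differs from
  \<open>w\<^sub>0\<close>. Then \<open>(1 - x\<^sub>i) G\<^sub>w\<close> is the alternating sum of \<open>G\<^sub>v\<close> over all \<open>v\<close> obtained from \<open>w\<close> by a
  (possibly empty) chain of Bruhat covers \<open>t\<^sub>i\<^sub>j\<close> with decreasing \<open>j > i\<close>; this follows by induction from
  the way the isobaric divided differences act on both sides. So \<open>x\<^sub>i G\<^sub>w\<close> is a combination of
  polynomials \<open>G\<^sub>v\<close> with \<open>v\<close> closer to \<open>w\<^sub>0\<close>. The columns of \<open>D(v)\<close> and \<open>D(w)\<close> are easy to compare, since
  rows \<open>1, ..., i - 1\<close> are full: from spanning sets of the columns of \<open>D(v)\<close> one gets spanning sets of the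
  columns of \<open>D(w)\<close> by deleting \<open>i\<close> once. Hence every exponent of \<open>G\<^sub>w\<close> is a sum of indicator vectors of
  spanning sets, one for each column, and the claim on Newton polytopes follows by convexity.\<close>

subsection \<open>Isobaric divided differences\<close>

abbreviation adj :: "nat \<Rightarrow> nat \<Rightarrow> nat" where
  "adj j \<equiv> Transposition.transpose j (Suc j)"

abbreviation swap_exps :: "nat \<Rightarrow> (nat \<Rightarrow>\<^sub>0 nat) \<Rightarrow> (nat \<Rightarrow>\<^sub>0 nat)" where
  "swap_exps j \<equiv> Poly_Mapping.map_key (adj j)"

section \<open>Exchange of two adjacent variables in exponents and polynomials\<close>

lemma lookup_map_key_inj: "inj f \<Longrightarrow> Poly_Mapping.lookup (Poly_Mapping.map_key f p) k = Poly_Mapping.lookup p (f k)"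
  by (simp add: Poly_Mapping.map_key.rep_eq)

lemma inj_adj [simp]: "inj (adj j)"
  by (rule inj_on_inverseI[where g = "adj j"]) simp

lemma swap_exps_swap_exps [simp]: "swap_exps j (swap_exps j a) = a"
  by (simp add: Poly_Mapping.map_key_compose Poly_Mapping.map_key_id id_def)

lemma inj_swap_exps [simp]: "inj (swap_exps j)"
  by (rule inj_on_inverseI[where g = "swap_exps j"]) simp

lemma swap_exps_add: "swap_exps j (a + b) = swap_exps j a + swap_exps j b"
  by (simp add: Poly_Mapping.map_key_plus)

lemma swap_exps_single: "swap_exps j (Poly_Mapping.single i b) = Poly_Mapping.single (adj j i) b"
  using Poly_Mapping.map_key_single[OF inj_adj[of j], of "adj j i" b] by simp

lemma lookup_swap_vars: "Poly_Mapping.lookup (swap_vars j f) a = Poly_Mapping.lookup f (swap_exps j a)"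
  by (simp add: swap_vars_def lookup_map_key_inj)

lemma swap_vars_swap_vars [simp]: "swap_vars j (swap_vars j f) = f"
  by (rule poly_mapping_eqI) (simp add: lookup_swap_vars)

lemma swap_vars_diff: "swap_vars j (f - g) = swap_vars j f - swap_vars j g"
  by (rule poly_mapping_eqI) (simp add: lookup_swap_vars lookup_minus)

lemma swap_vars_0 [simp]: "swap_vars j 0 = 0"
  by (rule poly_mapping_eqI) (simp add: lookup_swap_vars)

lemma swap_vars_single:
  "swap_vars j (Poly_Mapping.single a c) = Poly_Mapping.single (swap_exps j a) c"
  using Poly_Mapping.map_key_single[OF inj_swap_exps[of j], of "swap_exps j a" c]
  by (simp add: swap_vars_def)

lemma swap_vars_1 [simp]: "swap_vars j 1 = 1"
  using swap_vars_single[of j 0 1] by simp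

text \<open>Polynomials form the free abelian group on exponent vectors, so a property closed under
  subtraction needs checking only on monomials with coefficient 1.\<close>

lemma ipoly_induct [case_names zero monom diff]:
  fixes f :: ipoly
  assumes "P 0" and "\<And>a. P (frag_of a)" and "\<And>f g. P f \<Longrightarrow> P g \<Longrightarrow> P (f - g)"
  shows "P f"
  by (rule frag_induction[of f UNIV]) (use assms in auto)

lemma swap_vars_mult: "swap_vars j (f * g) = swap_vars j f * swap_vars j g"
proof -
  have monomials: "swap_vars j (frag_of a * frag_of b) =
      swap_vars j (frag_of a) * swap_vars j (frag_of b)"
    for a b
    by (simp add: mult_single swap_vars_single swap_exps_add)
  have left: "swap_vars j (frag_of a * g) = swap_vars j (frag_of a) * swap_vars j g" for a
    by (induction g rule: ipoly_induct)
       (simp_all only: monomials swap_vars_diff right_diff_distrib swap_vars_0 mult_zero_right)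
  show ?thesis
    by (induction f rule: ipoly_induct)
       (simp_all only: left swap_vars_diff left_diff_distrib swap_vars_0 mult_zero_left)
qed

lemma swap_vars_power: "swap_vars j (f ^ k) = swap_vars j f ^ k"
  by (induction k) (simp_all add: swap_vars_mult)

lemma swap_vars_prod: "swap_vars j (\<Prod>i\<in>I. f i) = (\<Prod>i\<in>I. swap_vars j (f i))"
  by (induction I rule: infinite_finite_induct) (simp_all add: swap_vars_mult)

lemma swap_vars_var: "swap_vars j (var i) = var (adj j i)"
  by (simp add: var_def swap_vars_single swap_exps_single)

lemma swap_vars_var_other: "i \<noteq> j \<Longrightarrow> i \<noteq> Suc j \<Longrightarrow> swap_vars j (var i) = var i"
  by (simp add: swap_vars_var)

lemma var_eq_iff [simp]: "var i = var k \<longleftrightarrow> i = k"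
proof
  assume "var i = var k"
  then have "Poly_Mapping.single i (1::nat) = Poly_Mapping.single k 1"
    unfolding var_def by (metis frag_of_eq)
  then have "Poly_Mapping.lookup (Poly_Mapping.single i (1::nat)) k = 1"
    by simp
  then show "i = k" by (metis lookup_single_not_eq zero_neq_one)
qed simp

lemma var_power: "var i ^ k = Poly_Mapping.single (Poly_Mapping.single i k) 1"
  by (induction k) (simp_all add: var_def mult_single flip: single_add)

lemma frag_of_induct_vars:
  assumes one: "P 1" and var: "\<And>i. P (var i)" and mult: "\<And>f g. P f \<Longrightarrow> P g \<Longrightarrow> P (f * g)"
  shows "P (frag_of a)"
proof (induction a rule: update_induct)
  case const
  then show ?case using one by simp
next
  case (update f a b)
  have "P (var a ^ k)" for k
    by (induction k) (simp_all add: one var mult)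
  moreover have "Poly_Mapping.update a b f = Poly_Mapping.single a b + f"
    using update(1)
    by (intro poly_mapping_eqI) (auto simp: lookup_update lookup_add lookup_single when_def in_keys_iff)
  ultimately show ?case
    using mult[of "var a ^ b" "frag_of f"] update(3) by (simp add: var_power mult_single)
qed

text \<open>Guarantees that the quotient behind \<open>divdiff\<close> exists. For a variable the
  difference is 0 or the divisor up to sign; the twisted product rule carries divisibility to
  monomials, and subtraction to all polynomials.\<close>

lemma var_diff_dvd: "var j - var (Suc j) dvd f - swap_vars j f"
proof (induction f rule: ipoly_induct)
  case (monom a)
  show ?case
  proof (induction a rule: frag_of_induct_vars)
    case (2 i)
    show ?case
      by (cases "i = j"; cases "i = Suc j")
         (auto simp: swap_vars_var minus_diff_eq[of "var j" "var (Suc j)", symmetric]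
               simp del: minus_diff_eq)
  next
    case (3 f g)
    have "f * g - swap_vars j (f * g) = (f - swap_vars j f) * g + swap_vars j f * (g - swap_vars j g)"
      by (simp add: swap_vars_mult algebra_simps)
    then show ?case using 3 by (simp add: dvd_add dvd_mult dvd_mult2)
  qed simp
next
  case (diff a b)
  have "a - b - swap_vars j (a - b) = (a - swap_vars j a) - (b - swap_vars j b)"
    by (simp add: swap_vars_diff)
  then show ?case using diff by (simp only: dvd_diff)
qed simp_all

text \<open>There are no zero divisors and x_j - x_{j+1} is nonzero, so any quotient that is found
  is the one meant by \<open>THE\<close>. Later identities are therefore checked after multiplying
  by x_j - x_{j+1}.\<close>

lemma divdiff_eqI:
  assumes "(var j - var (Suc j)) * g = f - swap_vars j f"
  shows "divdiff j f = g"
  unfolding divdiff_def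
proof (rule the_equality)
  fix g' assume "(var j - var (Suc j)) * g' = f - swap_vars j f"
  with assms have "(var j - var (Suc j)) * g' = (var j - var (Suc j)) * g" by simp
  then show "g' = g" by simp
qed (fact assms)

lemma divdiff_mult_var_diff: "(var j - var (Suc j)) * divdiff j f = f - swap_vars j f"
proof -
  obtain g where g: "f - swap_vars j f = (var j - var (Suc j)) * g"
    using var_diff_dvd by (rule dvdE)
  with divdiff_eqI[of j g f] show ?thesis by simp
qed

lemma isobaric_divdiff_eqI:
  assumes "(var j - var (Suc j)) * g = (1 - var (Suc j)) * f - (1 - var j) * swap_vars j f"
  shows "isobaric_divdiff j f = g"
  unfolding isobaric_divdiff_def using assms
  by (intro divdiff_eqI) (simp add: swap_vars_mult swap_vars_diff swap_vars_var)

lemma isobaric_divdiff_mult_var_diff: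
  "(var j - var (Suc j)) * isobaric_divdiff j f = (1 - var (Suc j)) * f - (1 - var j) * swap_vars j f"
  by (simp add: isobaric_divdiff_def divdiff_mult_var_diff swap_vars_mult swap_vars_diff swap_vars_var)

section \<open>Algebraic rules for the isobaric operators\<close>

lemma isobaric_divdiff_diff:
  "isobaric_divdiff j (f - g) = isobaric_divdiff j f - isobaric_divdiff j g"
  by (rule isobaric_divdiff_eqI)
     (simp only: right_diff_distrib[of "var j - _"] isobaric_divdiff_mult_var_diff swap_vars_diff,
      simp add: algebra_simps)

lemma isobaric_divdiff_mult_symmetric:
  assumes "swap_vars j c = c"
  shows "isobaric_divdiff j (c * f) = c * isobaric_divdiff j f"
proof (rule isobaric_divdiff_eqI)
  have "(var j - var (Suc j)) * (c * isobaric_divdiff j f) = c * ((var j - var (Suc j)) * isobaric_divdiff j f)"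
    by (simp only: mult.left_commute)
  also have "\<dots> = (1 - var (Suc j)) * (c * f) - (1 - var j) * swap_vars j (c * f)"
    unfolding isobaric_divdiff_mult_var_diff
    by (simp add: swap_vars_mult assms algebra_simps)
  finally show "(var j - var (Suc j)) * (c * isobaric_divdiff j f) = \<dots>" .
qed

lemma isobaric_divdiff_symmetric: "swap_vars j f = f \<Longrightarrow> isobaric_divdiff j f = f"
  by (rule isobaric_divdiff_eqI) (simp add: algebra_simps)

text \<open>The numerator and the divisor x_j - x_{j+1} both change sign under s_j, so their
  quotient is symmetric.\<close>

lemma swap_vars_isobaric_divdiff: "swap_vars j (isobaric_divdiff j f) = isobaric_divdiff j f"
proof -
  let ?g = "isobaric_divdiff j f"
  have "swap_vars j ((var j - var (Suc j)) * ?g) = - ((var j - var (Suc j)) * ?g)"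
    unfolding isobaric_divdiff_mult_var_diff
    by (simp add: swap_vars_mult swap_vars_diff swap_vars_var)
  moreover have "swap_vars j ((var j - var (Suc j)) * ?g) = - ((var j - var (Suc j)) * swap_vars j ?g)"
    by (simp add: swap_vars_mult swap_vars_diff swap_vars_var algebra_simps)
  ultimately have "(var j - var (Suc j)) * swap_vars j ?g = (var j - var (Suc j)) * ?g"
    by (simp only: neg_equal_iff_equal)
  then show ?thesis by simp
qed

lemma isobaric_divdiff_idem: "isobaric_divdiff j (isobaric_divdiff j f) = isobaric_divdiff j f"
  by (intro isobaric_divdiff_symmetric swap_vars_isobaric_divdiff)

text \<open>Transfers the cotransition formula from position j + 1 to position j: the right-hand
  side has the shape of \<open>cotransition_sum_shift\<close>.\<close>

lemma isobaric_divdiff_leibniz: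
  "(1 - var j) * isobaric_divdiff j f =
     isobaric_divdiff j ((1 - var (Suc j)) * f) - (1 - var (Suc j)) * f"
proof -
  let ?h = "(1 - var (Suc j)) * f" and ?x = "var j" and ?y = "var (Suc j)"
  have "isobaric_divdiff j ?h = (1 - ?x) * isobaric_divdiff j f + ?h"
  proof (rule isobaric_divdiff_eqI)
    have "(?x - ?y) * ((1 - ?x) * isobaric_divdiff j f + ?h)
        = (1 - ?x) * ((?x - ?y) * isobaric_divdiff j f) + (?x - ?y) * ?h"
      by (simp add: algebra_simps)
    also have "\<dots> = (1 - ?y) * ?h - (1 - ?x) * swap_vars j ?h"
      unfolding isobaric_divdiff_mult_var_diff
      by (simp add: swap_vars_mult swap_vars_diff swap_vars_var algebra_simps)
    finally show "(?x - ?y) * ((1 - ?x) * isobaric_divdiff j f + ?h) = \<dots>" .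
  qed
  then show ?thesis by simp
qed

lemma isobaric_divdiff_var: "isobaric_divdiff j (var j) = 1"
  by (rule isobaric_divdiff_eqI) (simp add: swap_vars_var algebra_simps)

lemma var_mult_isobaric_divdiff_groth_top:
  assumes "i \<in> {1..<n}"
  shows "var i * isobaric_divdiff i (groth_top n) = groth_top n"
proof -
  \<comment> \<open>The exponents of x_i and x_{i+1} differ by exactly one, so splitting off one
    factor x_i leaves a cofactor symmetric in the two variables.\<close>
  define m where "m = (\<Prod>k\<in>{1..n} - {i, Suc i}. var k ^ (n - k)) * (var i * var (Suc i)) ^ (n - Suc i)"
  have "groth_top n = (var i ^ (n - i) * var (Suc i) ^ (n - Suc i)) *
      (\<Prod>k\<in>{1..n} - {i, Suc i}. var k ^ (n - k))"
    unfolding groth_top_def using assms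
    by (subst prod.subset_diff[of "{i, Suc i}"]) (auto simp: mult.commute)
  moreover have "n - i = Suc (n - Suc i)" using assms by auto
  ultimately have top: "groth_top n = m * var i"
    by (simp add: m_def power_mult_distrib mult_ac)
  have "swap_vars i m = m"
    unfolding m_def swap_vars_mult swap_vars_power swap_vars_prod
    by (intro arg_cong2[where f = "(*)"] prod.cong)
       (auto simp: swap_vars_power swap_vars_var_other swap_vars_var mult.commute)
  with top show ?thesis
    by (simp add: isobaric_divdiff_mult_symmetric isobaric_divdiff_var mult.commute)
qed

subsection \<open>Spanning sets of Rothe diagram columns\<close>

text \<open>This is the diagram column labelled \<open>w l\<close>, indexed by position so that
  columns before and after a transposition of positions can be compared at the same
  \<open>l\<close>.\<close>

definition rows_above :: "(nat \<Rightarrow> nat) \<Rightarrow> nat \<Rightarrow> nat set" where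
  "rows_above w l = {k \<in> {1..<l}. w l < w k}"

lemma rothe_col_eq_rows_above:
  assumes "w permutes {1..n}" "l \<in> {1..n}"
  shows "rothe_col n w (w l) = rows_above w l"
  using assms permutes_in_image[OF assms(1), of l] permutes_inverses(2)[OF assms(1), of l]
  by (auto simp: rothe_col_def rothe_def rows_above_def)

lemma finite_rows_above [simp]: "finite (rows_above w l)"
  by (simp add: rows_above_def)

section \<open>Spanning sets of Schubert matroids through initial counts\<close>

lemma max0_le_iff: "finite D \<Longrightarrow> max0 D \<le> m \<longleftrightarrow> (\<forall>x\<in>D. x \<le> m)"
  by (auto simp: max0_def)

lemma max0_ge: "finite D \<Longrightarrow> x \<in> D \<Longrightarrow> x \<le> max0 D"
  by (auto simp: max0_def)

text \<open>Comparing initial counts amounts to comparing the sorted elements of \<open>D\<close> with the smallest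
  elements of \<open>A\<close>, so this is the spanning property without reference to a basis.\<close>
definition count_spanning :: "nat set \<Rightarrow> nat set \<Rightarrow> bool" where
  "count_spanning D A \<longleftrightarrow>
     A \<subseteq> {1..max0 D} \<and> (\<forall>m. card (D \<inter> {..m}) \<le> card (A \<inter> {..m}))"

text \<open>The indices whose entry is at most \<open>m\<close> form an initial segment, in
  bijection with the elements of \<open>S\<close> up to \<open>m\<close>; so \<open>k\<close>
  belongs to it exactly when \<open>k\<close> is below its size.\<close>

lemma sorted_list_of_set_nth_le_iff:
  fixes S :: "nat set"
  assumes "finite S" "k < card S"
  shows "sorted_list_of_set S ! k \<le> m \<longleftrightarrow> k < card (S \<inter> {..m})"
proof -
  let ?xs = "sorted_list_of_set S"
  have len: "length ?xs = card S" by simp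
  have "card (S \<inter> {..m}) = card {l. l < card S \<and> ?xs ! l \<le> m}"
  proof (rule sym, rule bij_betw_same_card[of "(!) ?xs"])
    have "bij_betw ((!) ?xs) {..<card S} S"
      using bij_betw_nth[of ?xs "{..<card S}" S] assms(1) by simp
    then show "bij_betw ((!) ?xs) {l. l < card S \<and> ?xs ! l \<le> m} (S \<inter> {..m})"
      by (auto simp: bij_betw_def inj_on_def)
  qed
  moreover have "k < card {l. l < card S \<and> ?xs ! l \<le> m}" if "?xs ! k \<le> m"
  proof -
    have "{..k} \<subseteq> {l. l < card S \<and> ?xs ! l \<le> m}"
      using that assms(2) sorted_nth_mono[OF sorted_sorted_list_of_set, of _ k S]
      by (auto intro: le_trans)
    then have "card {..k} \<le> card {l. l < card S \<and> ?xs ! l \<le> m}"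
      by (intro card_mono) auto
    then show ?thesis by simp
  qed
  moreover have "card {l. l < card S \<and> ?xs ! l \<le> m} \<le> k" if "\<not> ?xs ! k \<le> m"
  proof -
    have "l < k" if l: "l < card S" "?xs ! l \<le> m" for l
    proof (rule ccontr)
      assume "\<not> l < k"
      then have "?xs ! k \<le> ?xs ! l"
        using l(1) by (intro sorted_nth_mono) auto
      with l(2) \<open>\<not> ?xs ! k \<le> m\<close> show False by simp
    qed
    then have "{l. l < card S \<and> ?xs ! l \<le> m} \<subseteq> {..<k}" by auto
    then have "card {l. l < card S \<and> ?xs ! l \<le> m} \<le> card {..<k}"
      by (intro card_mono) auto
    then show ?thesis by simp
  qed
  ultimately show ?thesis by (metis not_le)
qed

lemma count_spanning_imp_schubert_spanning:
  assumes fin: "finite D" and sp: "count_spanning D A"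
  shows "schubert_spanning (max0 D) D A"
proof -
  let ?as = "sorted_list_of_set A"
  have sub: "A \<subseteq> {1..max0 D}" and cnt: "\<And>m. card (D \<inter> {..m}) \<le> card (A \<inter> {..m})"
    using sp by (auto simp: count_spanning_def)
  have finA: "finite A" using sub finite_subset by blast
  have "D \<inter> {..max0 D} = D" "A \<inter> {..max0 D} = A"
    using sub max0_ge[OF fin] by auto
  with cnt[of "max0 D"] have le: "card D \<le> card A" by simp
  \<comment> \<open>The smallest elements of \<open>A\<close>, as many as \<open>D\<close> has, are
    the best candidate for a basis inside \<open>A\<close>.\<close>
  define B where "B = set (take (card D) ?as)"
  have list_B: "sorted_list_of_set B = take (card D) ?as"
    unfolding B_def by (rule sorted_list_of_set.idem_if_sorted_distinct) (simp_all add: sorted_wrt_take)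
  have "B \<subseteq> A" unfolding B_def using finA by (metis set_sorted_list_of_set set_take_subset)
  moreover have "card B = card D"
    using le unfolding B_def by (subst distinct_card) auto
  moreover have "sorted_list_of_set B ! k \<le> sorted_list_of_set D ! k" if k: "k < card D" for k
  proof -
    have "k < card (D \<inter> {..sorted_list_of_set D ! k})"
      using sorted_list_of_set_nth_le_iff[OF fin k] by blast
    also note cnt
    finally have "?as ! k \<le> sorted_list_of_set D ! k"
      using sorted_list_of_set_nth_le_iff[OF finA] k le by simp
    with k show ?thesis by (simp add: list_B)
  qed
  ultimately show ?thesis
    using sub unfolding schubert_spanning_def schubert_basis_def by blast
qed

lemma count_spanning_refl: "finite D \<Longrightarrow> D \<subseteq> {1..} \<Longrightarrow> count_spanning D D"
  using max0_ge[of D] by (auto simp: count_spanning_def)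

text \<open>Moving an element of \<open>D\<close> down from \<open>j\<close> to \<open>i\<close>
  lowers no initial count and does not raise the maximum, so spanning for the moved set is the
  stronger condition.\<close>

lemma count_spanning_shift:
  assumes "count_spanning (insert i (D - {j})) A" "finite D" "i < j" "j \<in> D" "i \<notin> D"
  shows "count_spanning D A"
proof -
  have "max0 (insert i (D - {j})) \<le> max0 D"
    using assms max0_ge[of D] by (auto simp: max0_le_iff intro: less_imp_le order.trans)
  moreover have "card (D \<inter> {..m}) \<le> card (insert i (D - {j}) \<inter> {..m})" for m
  proof (cases "j \<le> m")
    case True
    then have "insert i (D - {j}) \<inter> {..m} = insert i (D \<inter> {..m} - {j})"
      using assms(3) by auto
    moreover have "card (insert i (D \<inter> {..m} - {j})) = card (D \<inter> {..m})"
      using assms True card_Suc_Diff1[of "D \<inter> {..m}" j] by (subst card_insert_disjoint) auto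
    ultimately show ?thesis by simp
  next
    case False
    then show ?thesis using assms(2) by (intro card_mono) auto
  qed
  ultimately show ?thesis
    using assms(1) unfolding count_spanning_def
    by (meson atLeastatMost_subset_iff le_refl order.trans)
qed

text \<open>The larger element \<open>z\<close> keeps the maximum in place when \<open>i\<close> is
  added, while initial counts can only grow.\<close>

lemma count_spanning_keep:
  assumes "count_spanning (insert i D) A" "finite D" "z \<in> D" "i < z"
  shows "count_spanning D A"
proof -
  have "max0 (insert i D) \<le> max0 D"
    using assms max0_ge[of D] by (auto simp: max0_le_iff intro: less_imp_le order.trans)
  moreover have "card (D \<inter> {..m}) \<le> card (insert i D \<inter> {..m})" for m
    using assms(2) by (intro card_mono) auto
  ultimately show ?thesis
    using assms(1) unfolding count_spanning_def
    by (meson atLeastatMost_subset_iff le_refl order.trans)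
qed

text \<open>Since \<open>insert i D\<close> contains all of 1, ..., i, the count at \<open>i\<close>
  forces \<open>A\<close> to contain them too. Removing \<open>i\<close> then lowers both counts by
  one from \<open>i\<close> onwards.\<close>

lemma count_spanning_drop:
  assumes sp: "count_spanning (insert i D) A" and fin: "finite D" and "i \<notin> D"
    and "{1..<i} \<subseteq> D" and "1 \<le> i"
  shows "i \<in> A" "count_spanning D (A - {i})"
proof -
  have sub: "A \<subseteq> {1..max0 (insert i D)}"
    and cnt: "\<And>m. card (insert i D \<inter> {..m}) \<le> card (A \<inter> {..m})"
    using sp by (auto simp: count_spanning_def)
  have "card {1..i} \<le> card (insert i D \<inter> {..i})"
    using assms by (intro card_mono) auto
  also note cnt[of i]
  finally have "card {1..i} \<le> card (A \<inter> {..i})" .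
  moreover have "A \<inter> {..i} \<subseteq> {1..i}" using sub by auto
  ultimately have "A \<inter> {..i} = {1..i}"
    by (intro card_seteq) auto
  moreover have "i \<in> {1..i}" using \<open>1 \<le> i\<close> by simp
  ultimately show "i \<in> A" by (metis IntD1)
  \<comment> \<open>The maximum may drop when \<open>i\<close> leaves. Elements below
    \<open>i\<close> lie in \<open>D\<close> by fullness; an element above \<open>i\<close> shows
    that the old maximum came from \<open>D\<close>.\<close>
  have "A - {i} \<subseteq> {1..max0 D}"
  proof
    fix x assume x: "x \<in> A - {i}"
    have "x \<le> max0 D"
    proof (cases "x < i")
      case True
      moreover have "1 \<le> x" using x sub by auto
      ultimately have "x \<in> D" using assms(4) by auto
      then show ?thesis using fin max0_ge by blast
    next
      case False
      then have "i < x" "x \<le> max0 (insert i D)" using x sub by auto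
      moreover have "y \<le> max i (max0 D)" if "y \<in> D" for y
        using max0_ge[OF fin that] by simp
      then have "max0 (insert i D) \<le> max i (max0 D)"
        using fin by (simp add: max0_le_iff)
      ultimately show ?thesis by simp
    qed
    then show "x \<in> {1..max0 D}" using x sub by auto
  qed
  moreover have "card (D \<inter> {..m}) \<le> card ((A - {i}) \<inter> {..m})" for m
  proof (cases "i \<le> m")
    case True
    then have "insert i D \<inter> {..m} = insert i (D \<inter> {..m})" "(A - {i}) \<inter> {..m} = A \<inter> {..m} - {i}"
      by auto
    with cnt[of m] fin \<open>i \<notin> D\<close> \<open>i \<in> A\<close> True show ?thesis by (simp add: card_Diff_singleton)
  next
    case False
    then have "insert i D \<inter> {..m} = D \<inter> {..m}" "(A - {i}) \<inter> {..m} = A \<inter> {..m}"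
      by auto
    with cnt[of m] show ?thesis by simp
  qed
  ultimately show "count_spanning D (A - {i})"
    by (auto simp: count_spanning_def)
qed

text \<open>Columns of the Rothe diagram are indexed by the position \<open>l\<close> of their label \<open>w l\<close>.\<close>
definition spanning_sums :: "nat \<Rightarrow> (nat \<Rightarrow> nat) \<Rightarrow> (nat \<Rightarrow>\<^sub>0 nat) set" where
  "spanning_sums n w =
     {a. \<exists>A. (\<forall>l\<in>{1..n}. count_spanning (rows_above w l) (A l)) \<and>
             (\<forall>k. Poly_Mapping.lookup a k = (\<Sum>l\<in>{1..n}. of_bool (k \<in> A l)))}"

text \<open>For injective \<open>v\<close> this says that exchanging positions \<open>i\<close> and
  \<open>j\<close> adds exactly one inversion.\<close>

definition covers :: "(nat \<Rightarrow> nat) \<Rightarrow> nat \<Rightarrow> nat \<Rightarrow> bool" where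
  "covers v i j \<longleftrightarrow> i < j \<and> v i < v j \<and> (\<forall>k. i < k \<longrightarrow> k < j \<longrightarrow> v k < v i \<or> v j < v k)"

text \<open>The consequence of agreeing with w_0 before \<open>i\<close> that the column comparison
  uses: rows 1, ..., i - 1 belong to every column at positions i, ..., n.\<close>

definition dominated_from :: "nat \<Rightarrow> nat \<Rightarrow> (nat \<Rightarrow> nat) \<Rightarrow> bool" where
  "dominated_from n i v \<longleftrightarrow> (\<forall>k\<in>{1..<i}. \<forall>l\<in>{i..n}. v l < v k)"

section \<open>Effect of a Bruhat cover on the columns\<close>

context
  fixes n i j :: nat and v :: "nat \<Rightarrow> nat"
  assumes inj: "inj v" and i: "1 \<le> i" and j: "j \<le> n" and cov: "covers v i j"
    and dom: "dominated_from n i v"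
begin

text \<open>Strictly between \<open>i\<close> and \<open>j\<close> the cover condition keeps
  \<open>v l\<close> out of the interval from \<open>v i\<close> to \<open>v j\<close>, so the new
  entry in row \<open>i\<close> compares with it as the old one did. At \<open>l = i\<close> all
  rows above carry larger entries by dominance.\<close>

lemma rows_above_cover_before:
  assumes "l < j"
  shows "rows_above (v \<circ> Transposition.transpose i j) l = rows_above v l"
proof -
  have "i < j" "v i < v j" using cov by (auto simp: covers_def)
  consider "l < i" | "l = i" | "i < l" by linarith
  then show ?thesis
  proof cases
    case 1
    then show ?thesis using \<open>i < j\<close> by (auto simp: rows_above_def Transposition.transpose_def)
  next
    case 2
    then show ?thesis using \<open>i < j\<close> j dom by (auto simp: rows_above_def Transposition.transpose_def dominated_from_def)
  next
    case 3
    then have "v l < v i \<or> v j < v l" using cov assms by (auto simp: covers_def)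
    with 3 assms \<open>v i < v j\<close> show ?thesis by (auto simp: rows_above_def Transposition.transpose_def)
  qed
qed

text \<open>Entries between \<open>i\<close> and \<open>j\<close> compare alike with
  \<open>v i\<close> and \<open>v j\<close>; only row \<open>i\<close>, which now carries the larger
  value, joins the column.\<close>

lemma rows_above_cover_at:
  "rows_above (v \<circ> Transposition.transpose i j) j = insert i (rows_above v j)"
  "i \<notin> rows_above v j" "{1..<i} \<subseteq> rows_above v j"
proof -
  have ij: "i < j" "v i < v j" using cov by (auto simp: covers_def)
  show "i \<notin> rows_above v j" "{1..<i} \<subseteq> rows_above v j"
    using ij j dom by (auto simp: rows_above_def dominated_from_def)
  show "rows_above (v \<circ> Transposition.transpose i j) j = insert i (rows_above v j)"
  proof (rule set_eqI)
    fix k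
    consider "k < i" | "k = i" | "i < k" "k < j" | "j \<le> k" by linarith
    then show "k \<in> rows_above (v \<circ> Transposition.transpose i j) j \<longleftrightarrow> k \<in> insert i (rows_above v j)"
    proof cases
      case 1
      then have "k \<ge> 1 \<Longrightarrow> v i < v k \<and> v j < v k"
        using ij j dom by (auto simp: dominated_from_def)
      with 1 ij show ?thesis by (auto simp: rows_above_def Transposition.transpose_def)
    next
      case 2
      with ij i show ?thesis by (auto simp: rows_above_def Transposition.transpose_def)
    next
      case 3
      then have "v k < v i \<or> v j < v k" using cov by (auto simp: covers_def)
      with 3 ij show ?thesis by (auto simp: rows_above_def Transposition.transpose_def)
    next
      case 4
      with ij show ?thesis by (auto simp: rows_above_def Transposition.transpose_def)
    qed
  qed
qed

text \<open>The column changes only if \<open>v l\<close> lies between \<open>v i\<close> and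
  \<open>v j\<close>; then the larger of the two entries moves from row \<open>j\<close> up to row
  \<open>i\<close>.\<close>

lemma rows_above_cover_after:
  assumes "j < l"
  shows "rows_above (v \<circ> Transposition.transpose i j) l = rows_above v l \<or>
    (rows_above (v \<circ> Transposition.transpose i j) l = insert i (rows_above v l - {j}) \<and>
     j \<in> rows_above v l \<and> i \<notin> rows_above v l)"
proof -
  have ij: "i < j" "v i < v j" using cov by (auto simp: covers_def)
  have "v l \<noteq> v i" "v l \<noteq> v j" using inj ij assms by (auto simp: inj_eq)
  then consider "v l < v i" | "v i < v l" "v l < v j" | "v j < v l" by linarith
  then show ?thesis
  proof cases
    case 2
    then show ?thesis using ij assms i by (intro disjI2) (auto simp: rows_above_def Transposition.transpose_def)
  qed (use ij assms in \<open>auto simp: rows_above_def Transposition.transpose_def\<close>)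
qed

lemma count_spanning_cover:
  assumes "count_spanning (rows_above (v \<circ> Transposition.transpose i j) l) A" "l \<noteq> j"
  shows "count_spanning (rows_above v l) A"
proof (cases "l < j")
  case True
  then show ?thesis using assms rows_above_cover_before by simp
next
  case False
  then have "j < l" using assms(2) by simp
  moreover have "i < j" using cov by (simp add: covers_def)
  ultimately show ?thesis
    using rows_above_cover_after[of l] assms(1) count_spanning_shift[of i "rows_above v l" j A] by auto
qed

text \<open>The sets chosen for \<open>v\<close> after the transposition also serve for
  \<open>v\<close>, except at column \<open>j\<close>, where \<open>i\<close> must be deleted. This
  is the single factor x_i.\<close>

lemma spanning_sums_cover:
  assumes "a \<in> spanning_sums n (v \<circ> Transposition.transpose i j)"
  shows "a \<in> (+) (Poly_Mapping.single i 1) ` spanning_sums n v"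
proof -
  from assms obtain A where
    A: "\<And>l. l \<in> {1..n} \<Longrightarrow> count_spanning (rows_above (v \<circ> Transposition.transpose i j) l) (A l)"
    and a: "\<And>k. Poly_Mapping.lookup a k = (\<Sum>l\<in>{1..n}. of_bool (k \<in> A l))"
    unfolding spanning_sums_def by blast
  have jn: "j \<in> {1..n}" using i j cov by (auto simp: covers_def)
  note drop = count_spanning_drop[OF A[OF jn, unfolded rows_above_cover_at(1)]
      finite_rows_above rows_above_cover_at(2,3) i]
  \<comment> \<open>Subtraction of exponents is truncated, but \<open>i\<close> lies in
    \<open>A j\<close>, so the exponent at \<open>i\<close> is positive and nothing is lost.\<close>
  define b where "b = a - Poly_Mapping.single i 1"
  define B where "B = A(j := A j - {i})"
  have split: "(\<Sum>l\<in>{1..n}. of_bool (k \<in> C l)) =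
      of_bool (k \<in> C j) + (\<Sum>l\<in>{1..n} - {j}. of_bool (k \<in> C l) :: nat)" for C k
    by (rule sum.remove) (use jn in auto)
  have count: "Poly_Mapping.lookup a k = of_bool (k = i) + (\<Sum>l\<in>{1..n}. of_bool (k \<in> B l))" for k
    unfolding a split[of k A] split[of k B] using drop(1) by (auto simp: B_def)
  have "\<forall>l\<in>{1..n}. count_spanning (rows_above v l) (B l)"
    using count_spanning_cover A drop(2) by (auto simp: B_def)
  moreover have "Poly_Mapping.lookup b k = (\<Sum>l\<in>{1..n}. of_bool (k \<in> B l))" for k
    unfolding b_def lookup_minus lookup_single count by (auto simp: when_def)
  ultimately have "b \<in> spanning_sums n v"
    unfolding spanning_sums_def by blast
  moreover have "a = Poly_Mapping.single i 1 + b"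
    by (rule poly_mapping_eqI) (auto simp: b_def lookup_add lookup_minus lookup_single when_def count)
  ultimately show ?thesis by blast
qed

text \<open>The cover condition puts \<open>v z\<close> above \<open>v j\<close>, so
  \<open>z\<close> lies in column \<open>j\<close> and \<open>i\<close> need not be deleted there.
  Thus a chain of several covers costs only one factor x_i.\<close>

lemma spanning_sums_cover_keep:
  assumes "a \<in> spanning_sums n (v \<circ> Transposition.transpose i j)"
    and z: "i < z" "z < j" "v i < v z"
  shows "a \<in> spanning_sums n v"
proof -
  from assms(1) obtain A where
    A: "\<And>l. l \<in> {1..n} \<Longrightarrow> count_spanning (rows_above (v \<circ> Transposition.transpose i j) l) (A l)"
    and a: "\<And>k. Poly_Mapping.lookup a k = (\<Sum>l\<in>{1..n}. of_bool (k \<in> A l))"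
    unfolding spanning_sums_def by blast
  have "z \<in> rows_above v j" using z i cov by (auto simp: rows_above_def covers_def)
  then have "count_spanning (rows_above v l) (A l)" if "l \<in> {1..n}" for l
    using A[OF that] count_spanning_cover[of l "A l"] z(1)
      count_spanning_keep[of i "rows_above v j" "A j" z] rows_above_cover_at(1)
    by (cases "l = j") auto
  with a show ?thesis unfolding spanning_sums_def by blast
qed

end

section \<open>The top polynomial\<close>

lemma groth_top_eq_single:
  "groth_top n = Poly_Mapping.single (\<Sum>i\<in>{1..n}. Poly_Mapping.single i (n - i)) 1"
proof -
  have "(\<Prod>i\<in>I. var i ^ f i) = Poly_Mapping.single (\<Sum>i\<in>I. Poly_Mapping.single i (f i)) 1" for I f
    by (induction I rule: infinite_finite_induct) (simp_all add: var_power mult_single)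
  then show ?thesis by (simp add: groth_top_def)
qed

lemma rows_above_longest_perm: "l \<in> {1..n} \<Longrightarrow> rows_above (longest_perm n) l = {1..<l}"
  by (auto simp: rows_above_def longest_perm_def)

lemma keys_groth_top: "Poly_Mapping.keys (groth_top n) \<subseteq> spanning_sums n (longest_perm n)"
proof -
  let ?a = "\<Sum>i\<in>{1..n}. Poly_Mapping.single i (n - i)"
  have "Poly_Mapping.lookup ?a k = (\<Sum>l\<in>{1..n}. of_bool (k \<in> {1..<l}))" for k
  proof -
    have "(\<Sum>l\<in>{1..n}. of_bool (k \<in> {1..<l}) :: nat) = card {l \<in> {1..n}. k \<in> {1..<l}}"
      by (simp add: sum.If_cases of_bool_def Int_def)
    also have "{l \<in> {1..n}. k \<in> {1..<l}} = (if k = 0 then {} else {Suc k..n})" by auto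
    finally show ?thesis
      by (simp add: lookup_sum lookup_single when_def sum.delta)
  qed
  moreover have "count_spanning {1..<l} {1..<l}" for l
    by (rule count_spanning_refl) auto
  ultimately have "?a \<in> spanning_sums n (longest_perm n)"
    unfolding spanning_sums_def using rows_above_longest_perm
    by (intro CollectI exI[of _ "\<lambda>l. {1..<l}"]) simp
  then show ?thesis by (simp add: groth_top_eq_single)
qed

subsection \<open>The cotransition formula\<close>

lemma permutes_comp_transpose:
  assumes "v permutes S" "i \<in> S" "j \<in> S"
  shows "v \<circ> Transposition.transpose i j permutes S"
  using permutes_compose[OF permutes_swap_id[OF assms(2,3)] assms(1)] .

lemma comp_transpose_cancel [simp]:
  "v \<circ> Transposition.transpose i j \<circ> Transposition.transpose i j = v"
  by (simp add: comp_assoc)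

lemma transpose_adj_commute:
  assumes "i \<notin> {j, Suc j}" "k \<notin> {j, Suc j}"
  shows "v \<circ> Transposition.transpose i k \<circ> adj j = v \<circ> adj j \<circ> Transposition.transpose i k"
  using assms by (auto simp: fun_eq_iff Transposition.transpose_def)

text \<open>Conjugation by s_j exchanges the transpositions of \<open>i\<close> with
  \<open>j\<close> and with \<open>j + 1\<close>. By the third identity a two-step chain, followed
  by s_j, meets the one-step chain through \<open>j\<close>.\<close>

lemma transpose_adj_conj:
  assumes "i \<notin> {j, Suc j}"
  shows "v \<circ> Transposition.transpose i j \<circ> adj j = v \<circ> adj j \<circ> Transposition.transpose i (Suc j)"
    "v \<circ> Transposition.transpose i (Suc j) \<circ> adj j = v \<circ> adj j \<circ> Transposition.transpose i j"
    "v \<circ> Transposition.transpose i (Suc j) \<circ> Transposition.transpose i j \<circ> adj j =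
       v \<circ> Transposition.transpose i j"
  using assms by (auto simp: fun_eq_iff Transposition.transpose_def)

text \<open>The alternating sum over chains of covers \<open>t\<^sub>i\<^sub>j\<close> with decreasing \<open>j \<le> m\<close>.\<close>
primrec cotransition_sum ::
  "((nat \<Rightarrow> nat) \<Rightarrow> ipoly) \<Rightarrow> nat \<Rightarrow> nat \<Rightarrow> (nat \<Rightarrow> nat) \<Rightarrow> ipoly" where
  "cotransition_sum G i 0 v = G v"
| "cotransition_sum G i (Suc m) v = cotransition_sum G i m v -
     (if covers v i (Suc m) then cotransition_sum G i m (v \<circ> Transposition.transpose i (Suc m)) else 0)"

lemma cotransition_sum_trivial:
  "(\<And>k. i < k \<Longrightarrow> k \<le> m \<Longrightarrow> v k < v i) \<Longrightarrow> cotransition_sum G i m v = G v"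
proof (induction m)
  case (Suc m)
  have "\<not> covers v i (Suc m)"
    using Suc.prems[of "Suc m"] by (auto simp: covers_def)
  with Suc show ?case by simp
qed simp

lemma cotransition_sum_le: "m \<le> i \<Longrightarrow> cotransition_sum G i m v = G v"
  by (rule cotransition_sum_trivial) simp

lemma groth_descent:
  assumes "is_grothendieck_family n G" "v permutes {1..n}" "j \<in> {1..<n}" "v (Suc j) < v j"
  shows "isobaric_divdiff j (G v) = G (v \<circ> adj j)"
proof -
  have "v \<circ> adj j permutes {1..n}"
    using assms by (intro permutes_comp_transpose) auto
  then have "G (v \<circ> adj j) = isobaric_divdiff j (G (v \<circ> adj j \<circ> adj j))"
    using assms unfolding is_grothendieck_family_def by force
  then show ?thesis by simp
qed

text \<open>At an ascent \<open>G v\<close> is in the image of an idempotent operator, hence fixed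
  by it.\<close>

lemma groth_ascent:
  assumes "is_grothendieck_family n G" "v permutes {1..n}" "j \<in> {1..<n}" "v j < v (Suc j)"
  shows "isobaric_divdiff j (G v) = G v"
proof -
  have "G v = isobaric_divdiff j (G (v \<circ> adj j))"
    using assms unfolding is_grothendieck_family_def by blast
  then show ?thesis by (metis isobaric_divdiff_idem)
qed

lemma isobaric_divdiff_0 [simp]: "isobaric_divdiff j 0 = 0"
  by (rule isobaric_divdiff_symmetric) simp

section \<open>Isobaric operators on alternating sums over chains\<close>

context
  fixes n i j :: nat and G :: "(nat \<Rightarrow> nat) \<Rightarrow> ipoly"
  assumes G: "is_grothendieck_family n G" and i: "1 \<le> i" and ij: "i < j" and jn: "j < n"
begin

text \<open>Chains that use only positions below \<open>j\<close> commute with s_j and keep the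
  descent at \<open>j\<close>, so the operator acts term by term.\<close>

lemma cotransition_sum_descent_below:
  assumes "v permutes {1..n}" "v (Suc j) < v j" "m < j"
  shows "isobaric_divdiff j (cotransition_sum G i m v) = cotransition_sum G i m (v \<circ> adj j)"
  using assms
proof (induction m arbitrary: v)
  case 0
  then show ?case using groth_descent[OF G] ij jn by (simp add: comp_def)
next
  case (Suc m)
  have "covers (v \<circ> adj j) i (Suc m) \<longleftrightarrow> covers v i (Suc m)"
    using Suc.prems ij by (auto simp: covers_def Transposition.transpose_def)
  moreover have "isobaric_divdiff j (cotransition_sum G i m (v \<circ> Transposition.transpose i (Suc m))) =
      cotransition_sum G i m (v \<circ> adj j \<circ> Transposition.transpose i (Suc m))"
    using Suc.prems ij jn i
    by (subst Suc.IH)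
       (auto intro!: permutes_comp_transpose simp: transpose_adj_commute Transposition.transpose_def)
  ultimately show ?case
    using Suc by (simp add: isobaric_divdiff_diff comp_def)
qed

lemma cotransition_sum_ascent_below:
  assumes "v permutes {1..n}" "v j < v (Suc j)" "m < j"
  shows "isobaric_divdiff j (cotransition_sum G i m v) = cotransition_sum G i m v"
  using assms
proof (induction m arbitrary: v)
  case 0
  then show ?case using groth_ascent[OF G] ij jn by simp
next
  case (Suc m)
  have "isobaric_divdiff j (cotransition_sum G i m (v \<circ> Transposition.transpose i (Suc m))) =
      cotransition_sum G i m (v \<circ> Transposition.transpose i (Suc m))"
    using Suc.prems ij jn i
    by (subst Suc.IH) (auto intro!: permutes_comp_transpose simp: Transposition.transpose_def)
  then show ?case
    using Suc by (simp add: isobaric_divdiff_diff)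
qed

text \<open>If both positions \<open>j\<close> and \<open>j + 1\<close> give covers of \<open>v\<close>, the term that moves \<open>v i\<close> to \<open>j\<close>
  only is fixed by the operator and cancels the one that moves it to \<open>j + 1\<close> and then to \<open>j\<close>.\<close>
lemma cotransition_sum_descent_at:
  assumes v: "v permutes {1..n}" "v (Suc j) < v j"
  shows "isobaric_divdiff j (cotransition_sum G i (Suc j) v) = cotransition_sum G i (Suc j) (v \<circ> adj j)"
proof -
  obtain m where m: "j = Suc m" using ij by (cases j) auto
  let ?t = "Transposition.transpose i j" and ?t' = "Transposition.transpose i (Suc j)"
  let ?K = "cotransition_sum G i m"
  have expand: "cotransition_sum G i (Suc j) v = ?K v - (if covers v i j then ?K (v \<circ> ?t) else 0) -
      (if covers v i (Suc j) then ?K (v \<circ> ?t') -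
         (if covers (v \<circ> ?t') i j then ?K (v \<circ> ?t' \<circ> ?t) else 0) else 0)" for v
    unfolding m by simp
  have perm: "v \<circ> ?t permutes {1..n}" "v \<circ> ?t' permutes {1..n}" "v \<circ> ?t' \<circ> ?t permutes {1..n}"
    using v(1) i ij jn by (auto intro!: permutes_comp_transpose)
  have ne: "i \<notin> {j, Suc j}" using ij by auto
  have inj: "v i \<noteq> v j" "v i \<noteq> v (Suc j)"
    using permutes_inj[OF v(1)] ne by (auto simp: inj_eq)
  have K: "isobaric_divdiff j (?K v) = ?K (v \<circ> adj j)"
    using cotransition_sum_descent_below[OF v] m by simp
  have vals: "(v \<circ> ?t) j = v i" "(v \<circ> ?t) (Suc j) = v (Suc j)" "(v \<circ> ?t') j = v j"
    "(v \<circ> ?t') (Suc j) = v i" "(v \<circ> ?t' \<circ> ?t) j = v (Suc j)" "(v \<circ> ?t' \<circ> ?t) (Suc j) = v i"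
    using ne by (auto simp: Transposition.transpose_def)
  \<comment> \<open>The cases count how many of the entries at \<open>j\<close> and
    \<open>j + 1\<close> exceed \<open>v i\<close>: none, only the larger one, which s_j moves to
    \<open>j + 1\<close>, or both.\<close>
  consider "v j < v i" | "v (Suc j) < v i" "v i < v j" | "v i < v (Suc j)"
    using inj v(2) by linarith
  then show ?thesis
  proof cases
    case 1
    then have "\<not> covers v i j" "\<not> covers v i (Suc j)"
      "\<not> covers (v \<circ> adj j) i j" "\<not> covers (v \<circ> adj j) i (Suc j)"
      using v(2) ne by (auto simp: covers_def Transposition.transpose_def)
    with K show ?thesis by (simp only: expand) simp
  next
    case 2
    then have "\<not> covers v i (Suc j)" "\<not> covers (v \<circ> adj j) i j"
      "\<not> covers (v \<circ> adj j \<circ> ?t') i j" "covers (v \<circ> adj j) i (Suc j) \<longleftrightarrow> covers v i j"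
      using v(2) ne by (auto simp: covers_def Transposition.transpose_def less_Suc_eq)
    moreover have "isobaric_divdiff j (?K (v \<circ> ?t)) = ?K (v \<circ> adj j \<circ> ?t')"
      using cotransition_sum_descent_below[OF perm(1), of m] 2 m vals transpose_adj_conj(1)[OF ne, of v]
      by simp
    ultimately show ?thesis using K by (simp only: expand) (simp add: isobaric_divdiff_diff)
  next
    case 3
    have "covers v i j \<Longrightarrow> covers v i (Suc j)" "\<not> covers (v \<circ> adj j) i (Suc j)"
      "covers (v \<circ> adj j) i j \<longleftrightarrow> covers v i (Suc j)"
      "covers v i (Suc j) \<Longrightarrow> covers (v \<circ> ?t') i j \<longleftrightarrow> covers v i j"
      using v(2) ne 3 ij by (force simp: covers_def Transposition.transpose_def less_Suc_eq)+
    moreover have "isobaric_divdiff j (?K (v \<circ> ?t)) = ?K (v \<circ> ?t)"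
      using cotransition_sum_ascent_below[OF perm(1), of m] 3 m vals by simp
    moreover have "isobaric_divdiff j (?K (v \<circ> ?t')) = ?K (v \<circ> adj j \<circ> ?t)"
      using cotransition_sum_descent_below[OF perm(2), of m] 3 v(2) m vals transpose_adj_conj(2)[OF ne, of v]
      by simp
    moreover have "isobaric_divdiff j (?K (v \<circ> ?t' \<circ> ?t)) = ?K (v \<circ> ?t)"
      using cotransition_sum_descent_below[OF perm(3), of m] 3 m vals transpose_adj_conj(3)[OF ne, of v]
      by simp
    ultimately show ?thesis using K
      by (simp only: expand) (auto simp: isobaric_divdiff_diff)
  qed
qed

lemma cotransition_sum_descent:
  assumes "Suc j \<le> m" "m \<le> n" "v permutes {1..n}" "v (Suc j) < v j"
  shows "isobaric_divdiff j (cotransition_sum G i m v) = cotransition_sum G i m (v \<circ> adj j)"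
  using assms
proof (induction m arbitrary: v rule: dec_induct)
  case base
  then show ?case by (intro cotransition_sum_descent_at)
next
  case (step m)
  \<comment> \<open>Beyond \<open>j + 1\<close>, s_j merely permutes the positions strictly between
    \<open>i\<close> and \<open>Suc m\<close>, so the cover condition there is unaffected.\<close>
  have "adj j ` {i<..<Suc m} = {i<..<Suc m}"
    using step.hyps ij by (intro permutes_image permutes_swap_id) auto
  moreover have "(\<forall>k\<in>{i<..<Suc m}. (v \<circ> adj j) k < v i \<or> v (Suc m) < (v \<circ> adj j) k) \<longleftrightarrow>
      (\<forall>k\<in>adj j ` {i<..<Suc m}. v k < v i \<or> v (Suc m) < v k)"
    by simp
  moreover have "adj j i = i" "adj j (Suc m) = Suc m"
    using step.hyps ij by auto
  ultimately have "covers (v \<circ> adj j) i (Suc m) \<longleftrightarrow> covers v i (Suc m)"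
    by (simp add: covers_def Ball_def imp_conjL)
  moreover have "isobaric_divdiff j (cotransition_sum G i m (v \<circ> Transposition.transpose i (Suc m))) =
      cotransition_sum G i m (v \<circ> adj j \<circ> Transposition.transpose i (Suc m))"
    using step.prems step.hyps ij i
    by (subst step.IH)
       (auto intro!: permutes_comp_transpose simp: transpose_adj_commute Transposition.transpose_def)
  ultimately show ?case
    using step by (simp add: isobaric_divdiff_diff comp_def)
qed

end

text \<open>Moving a maximal entry from position \<open>i + 1\<close> to position \<open>i\<close> turns chains of covers at
  position \<open>i\<close> into chains at position \<open>i + 1\<close>.\<close>
lemma cotransition_sum_shift:
  assumes G: "is_grothendieck_family n G" and i: "1 \<le> i"
    and "Suc i \<le> m" "m \<le> n" "v permutes {1..n}" "v i < v (Suc i)"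
    and "\<And>k. Suc i < k \<Longrightarrow> k \<le> n \<Longrightarrow> v k < v (Suc i)"
  shows "cotransition_sum G i m v =
    isobaric_divdiff i (cotransition_sum G (Suc i) m (v \<circ> adj i)) -
    cotransition_sum G (Suc i) m (v \<circ> adj i)"
  using assms(3-)
proof (induction m arbitrary: v rule: dec_induct)
  case base
  have "v \<circ> adj i permutes {1..n}"
    using base i by (intro permutes_comp_transpose) auto
  then have "isobaric_divdiff i (G (v \<circ> adj i)) = G v"
    using groth_descent[OF G, of "v \<circ> adj i" i] base i by simp
  moreover have "covers v i (Suc i)" using base by (simp add: covers_def)
  then have "cotransition_sum G i (Suc i) v = G v - G (v \<circ> adj i)"
    by (simp add: cotransition_sum_le)
  moreover have "cotransition_sum G (Suc i) (Suc i) (v \<circ> adj i) = G (v \<circ> adj i)"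
    by (rule cotransition_sum_le) simp
  ultimately show ?case by (simp only:)
next
  case (step m)
  let ?t = "Transposition.transpose i (Suc m)" and ?t' = "Transposition.transpose (Suc i) (Suc m)"
  have "v (Suc m) < v (Suc i)" using step by auto
  then have "covers (v \<circ> adj i) (Suc i) (Suc m) \<longleftrightarrow> covers v i (Suc m)"
    using step.hyps
    by (auto simp: covers_def Transposition.transpose_def; metis Suc_lessD Suc_lessI not_less_iff_gr_or_eq)
  moreover have comm: "v \<circ> ?t \<circ> adj i = v \<circ> adj i \<circ> ?t'"
    using step.hyps by (auto simp: fun_eq_iff Transposition.transpose_def)
  moreover have "cotransition_sum G i m (v \<circ> ?t) =
    isobaric_divdiff i (cotransition_sum G (Suc i) m (v \<circ> ?t \<circ> adj i)) -
    cotransition_sum G (Suc i) m (v \<circ> ?t \<circ> adj i)"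
  proof (rule step.IH)
    show "v \<circ> ?t permutes {1..n}"
      using step.prems step.hyps i by (intro permutes_comp_transpose) auto
  qed (use step.prems step.hyps in \<open>auto simp: Transposition.transpose_def\<close>)
  ultimately show ?case
    using step by (simp add: isobaric_divdiff_diff comp_def)
qed

lemma lookup_single_mult:
  fixes f :: ipoly
  shows "Poly_Mapping.lookup (Poly_Mapping.single k 1 * f) (k + a) = Poly_Mapping.lookup f a"
proof (induction f rule: ipoly_induct)
  case (monom b)
  then show ?case by (simp add: mult_single lookup_single when_def)
next
  case (diff f g)
  then show ?case by (simp add: right_diff_distrib lookup_minus)
qed simp

text \<open>Induction measure: it falls whenever a larger entry moves left, hence at each step
  towards w_0, whether by s_j at an ascent or by a cover.\<close>

definition position_weight :: "nat \<Rightarrow> (nat \<Rightarrow> nat) \<Rightarrow> nat" where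
  "position_weight n w = (\<Sum>k\<in>{1..n}. k * w k)"

lemma position_weight_transpose_less:
  assumes "1 \<le> i" "i < j" "j \<le> n" "w i < w j"
  shows "position_weight n (w \<circ> Transposition.transpose i j) < position_weight n w"
proof -
  have split: "position_weight n v = (i * v i + j * v j) + (\<Sum>k\<in>{1..n} - {i, j}. k * v k)" for v
    unfolding position_weight_def using assms by (subst sum.subset_diff[of "{i, j}"]) auto
  have "(\<Sum>k\<in>{1..n} - {i, j}. k * (w \<circ> Transposition.transpose i j) k) = (\<Sum>k\<in>{1..n} - {i, j}. k * w k)"
    by (rule sum.cong) auto
  \<comment> \<open>The weight falls by exactly \<open>d * e\<close>.\<close>
  moreover obtain d e where "j = i + d" "w j = w i + e" "d > 0" "e > 0"
    using assms by (metis less_imp_add_positive)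
  ultimately show ?thesis
    unfolding split by (simp add: algebra_simps)
qed

section \<open>Permutations that begin like w_0\<close>

lemma dominated_le:
  fixes n :: nat
  assumes w: "w permutes {1..n}" and dom: "\<And>k. 1 \<le> k \<Longrightarrow> k < i \<Longrightarrow> w k = n + 1 - k"
    and l: "1 \<le> l" "i \<le> l" "l \<le> n"
  shows "w l \<le> n + 1 - i"
proof (rule ccontr)
  assume neg: "\<not> w l \<le> n + 1 - i"
  have "w l \<in> {1..n}" using permutes_in_image[OF w, of l] l by simp
  \<comment> \<open>The value \<open>w l\<close> would already be taken at the earlier position
    \<open>n + 1 - w l\<close>, against injectivity.\<close>
  with neg l have k: "1 \<le> n + 1 - w l" "n + 1 - w l < i" "n + 1 - (n + 1 - w l) = w l"
    unfolding atLeastAtMost_iff by linarith+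
  then have "w (n + 1 - w l) = w l" using dom by simp
  then have "n + 1 - w l = l" using permutes_inj[OF w] by (simp add: inj_eq)
  with k(2) l show False by simp
qed

lemma dominated_preimage:
  fixes n :: nat
  assumes w: "w permutes {1..n}" and dom: "\<And>k. 1 \<le> k \<Longrightarrow> k < i \<Longrightarrow> w k = n + 1 - k"
    and i: "1 \<le> i" "i \<le> n" and ne: "w i \<noteq> n + 1 - i"
  obtains p where "i < p" "p \<le> n" "w p = n + 1 - i"
proof -
  have "n + 1 - i \<in> {1..n}" unfolding atLeastAtMost_iff using i by linarith
  then have "n + 1 - i \<in> w ` {1..n}" using permutes_image[OF w] by simp
  then obtain p where p: "p \<in> {1..n}" "w p = n + 1 - i" by auto
  then have "p \<noteq> i" "\<not> p < i" using ne dom[of p] i by auto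
  with p show ?thesis by (intro that[of p]) auto
qed

lemma decreasing_eq_longest_perm:
  fixes n :: nat
  assumes w: "w permutes {1..n}" and dec: "\<And>k l. 1 \<le> k \<Longrightarrow> k < l \<Longrightarrow> l \<le> n \<Longrightarrow> w l < w k"
  shows "w = longest_perm n"
proof -
  have "w k = n + 1 - k" if "1 \<le> k" "k \<le> n" for k
    using that
  proof (induction k rule: less_induct)
    case (less k)
    show ?case
    proof (rule ccontr)
      assume "w k \<noteq> n + 1 - k"
      then obtain p where "k < p" "p \<le> n" "w p = n + 1 - k"
        using dominated_preimage[OF w, of k] less by auto
      with dec[of k p] dominated_le[OF w, of k k] less show False by force
    qed
  qed
  then show ?thesis
    using permutes_not_in[OF w] by (auto simp: longest_perm_def fun_eq_iff)
qed

lemma cotransition: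
  assumes G: "is_grothendieck_family n G"
    and "w permutes {1..n}" "1 \<le> i" "i \<le> n"
    "\<And>k. 1 \<le> k \<Longrightarrow> k < i \<Longrightarrow> w k = n + 1 - k" "w i < n + 1 - i"
  shows "(1 - var i) * G w = cotransition_sum G i n w"
  using assms(2-)
proof (induction "position_weight n w" arbitrary: w i rule: less_induct)
  case less
  note w = less.prems(1) and dom = less.prems(4)
  obtain p where p: "i < p" "p \<le> n" "w p = n + 1 - i"
    using dominated_preimage[where i = i, OF w dom] less.prems by auto
  show ?case
  proof (cases "\<exists>j>i. j < n \<and> w j < w (Suc j)")
    \<comment> \<open>An ascent beyond \<open>i\<close> is removed by s_j; the operator commutes
      with multiplication by 1 - x_i and carries the chain sum of \<open>w \<circ> adj j\<close> to
      that of \<open>w\<close>.\<close>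
    case True
    then obtain j where j: "i < j" "j < n" "w j < w (Suc j)" by blast
    let ?u = "w \<circ> adj j"
    have u: "?u permutes {1..n}" using j w by (intro permutes_comp_transpose) auto
    have "(1 - var i) * G ?u = cotransition_sum G i n ?u"
      using j less.prems position_weight_transpose_less[of j "Suc j" n w] u
      by (intro less.hyps) auto
    moreover have "G w = isobaric_divdiff j (G ?u)"
      using groth_descent[OF G u, of j] j by simp
    moreover have "isobaric_divdiff j (cotransition_sum G i n ?u) = cotransition_sum G i n w"
      using cotransition_sum_descent[OF G less.prems(2) j(1,2), of n ?u] u j by simp
    moreover have "swap_vars j (1 - var i) = 1 - var i"
      using j by (simp add: swap_vars_diff swap_vars_var_other)
    ultimately show ?thesis
      by (simp only: isobaric_divdiff_mult_symmetric flip: \<open>(1 - var i) * G ?u = _\<close>)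
  next
    case False
    have neq: "w k \<noteq> w (Suc k)" for k
      using permutes_inj[OF w] by (simp add: inj_eq)
    have dec: "w l < w k" if "i < k" "k < l" "l \<le> n" for k l
      using that(2,3)
    proof (induction l)
      case (Suc l)
      then have "i < l" "l < n" using that(1) by auto
      then have "w (Suc l) < w l"
        using False neq[of l] by (meson linorder_neqE_nat)
      with Suc show ?case by (cases "k = l") auto
    qed simp
    have "w (Suc i) \<le> n + 1 - i"
      using dominated_le[where i = i and l = "Suc i", OF w dom] p by simp
    moreover have "w p \<le> w (Suc i)"
      using dec[of "Suc i" p] p by (cases "p = Suc i") auto
    ultimately have max: "w (Suc i) = n + 1 - i" using p by simp
    have i: "1 \<le> i" "i < n" using less.prems(2) p by auto
    have lt: "w i < w (Suc i)" using max less.prems(5) by simp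
    let ?u = "w \<circ> adj i"
    have u: "?u permutes {1..n}" using i w by (intro permutes_comp_transpose) auto
    have shift: "cotransition_sum G i n w =
        isobaric_divdiff i (cotransition_sum G (Suc i) n ?u) - cotransition_sum G (Suc i) n ?u"
      using p i dec[of "Suc i"] lt by (intro cotransition_sum_shift[OF G _ _ _ w]) simp_all
    have Gw: "G w = isobaric_divdiff i (G ?u)"
      using groth_descent[OF G u, of i] i lt by simp
    have domu: "?u k = n + 1 - k" if "1 \<le> k" "k < Suc i" for k
      using that dom max by (cases "k = i") auto
    have "?u (Suc i) \<le> n + 1 - Suc i"
      using dominated_le[where i = "Suc i" and l = "Suc i", OF u domu] p by simp
    then consider "?u (Suc i) < n + 1 - Suc i" | "?u (Suc i) = n + 1 - Suc i" by linarith
    then show ?thesis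
    proof cases
      case 1
      then have "(1 - var (Suc i)) * G ?u = cotransition_sum G (Suc i) n ?u"
        using i lt position_weight_transpose_less[of i "Suc i" n w]
        by (intro less.hyps u domu) simp_all
      then show ?thesis
        unfolding shift Gw by (simp only: isobaric_divdiff_leibniz)
    next
      case 2
      have below: "?u l < ?u k" if "Suc i \<le> k" "k < l" "l \<le> n" for k l
      proof (cases "k = Suc i")
        case True
        have "?u l \<le> n + 1 - Suc i"
          using dominated_le[where i = "Suc i" and l = l, OF u domu] that by simp
        moreover have "?u l \<noteq> ?u k" using permutes_inj[OF u] that by (simp only: inj_eq)
        ultimately show ?thesis using 2 True by simp
      next
        case False
        then show ?thesis using that dec[of k l] by simp
      qed
      have "?u = longest_perm n"
      proof (rule decreasing_eq_longest_perm[OF u])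
        fix k l assume kl: "1 \<le> k" "k < l" "l \<le> n"
        show "?u l < ?u k"
        proof (cases "k \<le> i")
          case True
          have "?u l \<le> n + 1 - Suc k"
            using kl True domu by (intro dominated_le[OF u]) auto
          with True kl domu[of k] show ?thesis by simp
        qed (use kl below in simp)
      qed
      then have top: "G ?u = groth_top n"
        using G by (simp add: is_grothendieck_family_def)
      have "cotransition_sum G (Suc i) n ?u = G ?u"
        by (rule cotransition_sum_trivial, rule below) simp_all
      then have "cotransition_sum G i n w = G w - G ?u"
        using shift Gw by simp
      moreover have "var i * G w = G ?u"
        unfolding Gw top using i by (intro var_mult_isobaric_divdiff_groth_top) auto
      ultimately show ?thesis by (simp add: left_diff_distrib)
    qed
  qed
qed

subsection \<open>Supports and Newton polytopes\<close>

text \<open>Subtracting \<open>G v\<close> removes the empty chain. Every other chain ends at a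
  permutation of weight below \<open>N\<close>, to which the assumption on supports applies.\<close>

lemma keys_cotransition_sum:
  assumes IH: "\<And>v. v permutes {1..n} \<Longrightarrow> position_weight n v < N \<Longrightarrow>
      Poly_Mapping.keys (G v) \<subseteq> spanning_sums n v"
    and i: "1 \<le> i" and "m \<le> n" "v permutes {1..n}" "dominated_from n i v" "position_weight n v \<le> N"
  shows "Poly_Mapping.keys (cotransition_sum G i m v - G v) \<subseteq>
    (+) (Poly_Mapping.single i 1) ` spanning_sums n v"
  using assms(3-)
proof (induction m arbitrary: v)
  case (Suc m)
  let ?S = "(+) (Poly_Mapping.single i 1) ` spanning_sums n v"
  have rest: "Poly_Mapping.keys (cotransition_sum G i m v - G v) \<subseteq> ?S"
    using Suc by simp
  show ?case
  proof (cases "covers v i (Suc m)")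
    case True
    let ?u = "v \<circ> Transposition.transpose i (Suc m)"
    have im: "i < Suc m" "v i < v (Suc m)" using True by (auto simp: covers_def)
    have u: "?u permutes {1..n}" using Suc.prems i im by (intro permutes_comp_transpose) auto
    have less: "position_weight n ?u < N"
      using position_weight_transpose_less[of i "Suc m" n v] i im Suc.prems by simp
    have "dominated_from n i ?u"
      using Suc.prems im by (auto simp: dominated_from_def Transposition.transpose_def)
    then have IHu: "Poly_Mapping.keys (cotransition_sum G i m ?u - G ?u) \<subseteq>
        (+) (Poly_Mapping.single i 1) ` spanning_sums n ?u"
      using Suc.IH u less Suc.prems by simp
    note cov = permutes_inj[OF Suc.prems(2)] i Suc.prems(1) True Suc.prems(3)
    have "Poly_Mapping.keys (G ?u) \<subseteq> ?S"
      using IH[OF u less] spanning_sums_cover[OF cov] by blast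
    moreover have "Poly_Mapping.keys (cotransition_sum G i m ?u - G ?u) \<subseteq> ?S"
    \<comment> \<open>Either an entry in between exceeds \<open>v i\<close>, and further covers cost
      no second factor, or no cover can follow this one.\<close>
    proof (cases "\<exists>z. i < z \<and> z < Suc m \<and> v i < v z")
      case True
      then show ?thesis using IHu spanning_sums_cover_keep[OF cov] by blast
    next
      case False
      then have "v k \<le> v i" if "i < k" "k < Suc m" for k
        using that by (meson not_less)
      then have "cotransition_sum G i m ?u = G ?u"
        using im by (intro cotransition_sum_trivial) (force simp: Transposition.transpose_def)
      then show ?thesis by simp
    qed
    moreover have combine: "Poly_Mapping.keys (f - (g + h)) \<subseteq> ?S"
      if "Poly_Mapping.keys f \<subseteq> ?S" "Poly_Mapping.keys g \<subseteq> ?S" "Poly_Mapping.keys h \<subseteq> ?S"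
      for f g h :: ipoly
      using that keys_diff[of f "g + h"] keys_add[of g h] by blast
    moreover have "cotransition_sum G i (Suc m) v - G v =
        (cotransition_sum G i m v - G v) - ((cotransition_sum G i m ?u - G ?u) + G ?u)"
      using True by simp
    ultimately show ?thesis
      using rest by (simp only: combine)
  next
    case False
    with rest show ?thesis by simp
  qed
qed simp

lemma keys_groth:
  assumes G: "is_grothendieck_family n G" and "w permutes {1..n}"
  shows "Poly_Mapping.keys (G w) \<subseteq> spanning_sums n w"
  using assms(2)
proof (induction "position_weight n w" arbitrary: w rule: less_induct)
  case less
  note w = less.prems
  show ?case
  proof (cases "w = longest_perm n")
    case True
    then show ?thesis
      using G keys_groth_top by (simp add: is_grothendieck_family_def)
  next
    case False
    define i where "i = (LEAST i. w i \<noteq> longest_perm n i)"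
    obtain l where "w l \<noteq> longest_perm n l" using False by (auto simp: fun_eq_iff)
    then have "w i \<noteq> longest_perm n i"
      unfolding i_def by (rule LeastI)
    moreover have before: "w k = longest_perm n k" if "k < i" for k
      using not_less_Least[of k "\<lambda>i. w i \<noteq> longest_perm n i"] that by (auto simp: i_def)
    ultimately have i: "1 \<le> i" "i \<le> n" "w i \<noteq> n + 1 - i"
      using permutes_not_in[OF w, of i] by (auto simp: longest_perm_def split: if_splits)
    have dom: "w k = n + 1 - k" if "1 \<le> k" "k < i" for k
      using before[OF that(2)] that i by (simp add: longest_perm_def)
    have le: "w l \<le> n + 1 - i" if "i \<le> l" "l \<le> n" for l
      using dominated_le[where i = i, OF w dom] that i by simp
    have eq: "(1 - var i) * G w = cotransition_sum G i n w"
      using i le[of i] by (intro cotransition[OF G w] dom) auto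
    have "- (var i * G w) = cotransition_sum G i n w - G w"
      unfolding eq[symmetric] by (simp add: left_diff_distrib)
    moreover have "dominated_from n i w"
      unfolding dominated_from_def using le dom by (fastforce simp: less_Suc_eq_le)
    ultimately have sub: "Poly_Mapping.keys (var i * G w) \<subseteq>
        (+) (Poly_Mapping.single i 1) ` spanning_sums n w"
      using keys_cotransition_sum[of n "position_weight n w" G i n w] less i by (metis keys_minus order_refl)
    show ?thesis
    proof
      \<comment> \<open>Multiplication by x_i shifts exponents injectively, so the shift can be
        undone.\<close>
      fix a assume "a \<in> Poly_Mapping.keys (G w)"
      then have "Poly_Mapping.single i 1 + a \<in> Poly_Mapping.keys (var i * G w)"
        by (simp add: in_keys_iff var_def lookup_single_mult)
      with sub show "a \<in> spanning_sums n w" by auto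
    qed
  qed
qed

text \<open>\<open>conv_hull\<close> weights points of a set, while the points \<open>g v\<close>
  may coincide; coefficients are therefore collected over the fibres of \<open>g\<close>.\<close>

lemma convex_combination_in_conv_hull:
  fixes g :: "'a \<Rightarrow> nat \<Rightarrow> real"
  assumes "finite F" "F \<noteq> {}" "\<And>v. v \<in> F \<Longrightarrow> 0 \<le> u v" "(\<Sum>v\<in>F. u v) = 1" "\<And>v. v \<in> F \<Longrightarrow> g v \<in> S"
  shows "(\<lambda>k. \<Sum>v\<in>F. u v * g v k) \<in> conv_hull S"
proof -
  define c where "c y = (\<Sum>v | v \<in> F \<and> g v = y. u v)" for y
  have "(\<Sum>y\<in>g ` F. c y) = 1"
    unfolding c_def using sum.image_gen[OF assms(1), of u g] assms(4) by simp
  moreover have "(\<Sum>v\<in>F. u v * g v k) = (\<Sum>y\<in>g ` F. c y * y k)" for k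
    unfolding c_def sum_distrib_right
    by (subst sum.image_gen[OF assms(1), of _ g]) (intro sum.cong, auto)
  moreover have "0 \<le> c y" for y
    unfolding c_def using assms(3) by (intro sum_nonneg) auto
  ultimately show ?thesis
    unfolding conv_hull_def using assms(1,2,5)
    by (intro CollectI exI[of _ "g ` F"] exI[of _ c]) auto
qed

theorem theorem3p6:
  fixes n :: nat and w :: "nat \<Rightarrow> nat" and G :: "(nat \<Rightarrow> nat) \<Rightarrow> ipoly"
  assumes "n \<ge> 1"
    and "w permutes {1..n}"
    and "is_grothendieck_family n G"
  shows "newton (G w) \<subseteq>
           minkowski_sum {1..n}
             (\<lambda>j. spanning_polytope (max0 (rothe_col n w j)) (rothe_col n w j))"
proof
  fix x assume "x \<in> newton (G w)"
  then obtain F u where F: "finite F" "F \<noteq> {}" "\<And>v. v \<in> F \<Longrightarrow> 0 \<le> u v" "(\<Sum>v\<in>F. u v) = 1"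
    and keys: "F \<subseteq> (\<lambda>a i. real (Poly_Mapping.lookup a i)) ` Poly_Mapping.keys (G w)"
    and x: "x = (\<lambda>k. \<Sum>v\<in>F. u v * v k)"
    unfolding newton_def conv_hull_def by blast
  have "\<exists>A. (\<forall>l\<in>{1..n}. count_spanning (rows_above w l) (A l)) \<and>
      (\<forall>k. v k = (\<Sum>l\<in>{1..n}. indicator_vec (A l) k))" if v: "v \<in> F" for v
  proof -
    obtain a where a: "a \<in> spanning_sums n w" "v = (\<lambda>i. real (Poly_Mapping.lookup a i))"
      using v keys keys_groth[OF assms(3,2)] by blast
    then obtain A where "\<forall>l\<in>{1..n}. count_spanning (rows_above w l) (A l)"
      "\<And>k. Poly_Mapping.lookup a k = (\<Sum>l\<in>{1..n}. of_bool (k \<in> A l))"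
      unfolding spanning_sums_def by blast
    with a(2) show ?thesis
      by (intro exI[of _ A]) (auto simp: indicator_vec_def of_bool_def intro!: sum.cong)
  qed
  then obtain A where
    A: "\<And>v l. v \<in> F \<Longrightarrow> l \<in> {1..n} \<Longrightarrow> count_spanning (rows_above w l) (A v l)"
    and sum_A: "\<And>v k. v \<in> F \<Longrightarrow> v k = (\<Sum>l\<in>{1..n}. indicator_vec (A v l) k)"
    by metis
  \<comment> \<open>The coefficients \<open>u\<close> are reused in every column. Label
    \<open>j\<close> belongs to position \<open>inv w j\<close>, so the final sum is reindexed by
    \<open>inv w\<close>.\<close>
  define p where "p j = (\<lambda>k. \<Sum>v\<in>F. u v * indicator_vec (A v (inv w j)) k)" for j
  have "p j \<in> spanning_polytope (max0 (rothe_col n w j)) (rothe_col n w j)" if j: "j \<in> {1..n}" for j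
  proof -
    have "inv w j \<in> {1..n}" "w (inv w j) = j"
      using permutes_in_image[OF permutes_inv[OF assms(2)]] permutes_inverses(1)[OF assms(2)] j by blast+
    then have "schubert_spanning (max0 (rothe_col n w j)) (rothe_col n w j) (A v (inv w j))" if "v \<in> F" for v
      using A[OF that] rothe_col_eq_rows_above[OF assms(2), of "inv w j"]
        count_spanning_imp_schubert_spanning finite_rows_above by metis
    then show ?thesis
      unfolding spanning_polytope_def p_def
      by (intro convex_combination_in_conv_hull F) auto
  qed
  moreover have "x k = (\<Sum>j\<in>{1..n}. p j k)" for k
  proof -
    have "x k = (\<Sum>v\<in>F. \<Sum>l\<in>{1..n}. u v * indicator_vec (A v l) k)"
      unfolding x
    proof (rule sum.cong)
      fix v assume "v \<in> F"
      then have "v k = (\<Sum>l\<in>{1..n}. indicator_vec (A v l) k)" by (rule sum_A)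
      then show "u v * v k = (\<Sum>l\<in>{1..n}. u v * indicator_vec (A v l) k)"
        by (simp only: sum_distrib_left)
    qed simp
    also have "\<dots> = (\<Sum>l\<in>{1..n}. \<Sum>v\<in>F. u v * indicator_vec (A v l) k)"
      by (rule sum.swap)
    also have "\<dots> = (\<Sum>j\<in>{1..n}. p j k)"
      unfolding p_def
      by (rule sum.permute[OF permutes_inv[OF assms(2)], unfolded comp_def])
    finally show ?thesis .
  qed
  ultimately show "x \<in> minkowski_sum {1..n}
      (\<lambda>j. spanning_polytope (max0 (rothe_col n w j)) (rothe_col n w j))"
    unfolding minkowski_sum_def by (intro CollectI exI[of _ p]) (auto simp: fun_eq_iff)
qed

end
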